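(* Suppose $\Delta'_n=\det(\nu_{i+j,n})_{i,j=0}^{n}\neq0$ for all $n\ge0$. Then for each $n\ge0$, \[ P_n(x)=\frac{1}{\Delta'_n}\det\begin{pmatrix}(\nu_{i+j,n})_{0\le i\le n-1,\ 0\le j\le n}\\ (x^j)_{0\le j\le n}\end{pmatrix}, \] where the last row of the $(n+1)\times(n+1)$ matrix is $(1,x,\dots,x^n)$, and \[ \Delta'_n=\prod_{k=1}^n\frac{1}{(-a_k)^kP_k(-\lambda_k/a_k)}. \]
   Context: Let $\{b_n\}_{n\ge0},\{a_n\}_{n\ge0},\{\lambda_n\}_{n\ge0}$ be sequences of complex numbers. Define monic polynomials $P_n(x)$ by $P_{-1}(x)=0$, $P_0(x)=1$ and $P_{n+1}(x)=(x-b_n)P_n(x)-(a_nx+\lambda_n)P_{n-1}(x)$ for $n\ge0$. Let $d_0(x)=1$, $d_m(x)=\prod_{i=1}^m(a_ix+\lambda_i)$, and $Q_m(x)=P_m(x)/d_m(x)$. Assume $a_n\neq0$ and $P_n(-\lambda_n/a_n)\neq 0$ for all $n\ge1$. Let $V=\mathrm{span}\{x^nQ_m(x):n,m\ge0\}$ (rational functions; it contains every $x^n/d_m(x)$), and let $\mathcal{L}$ be the unique linear functional on $V$ with $\mathcal{L}(1)=1$ and $\mathcal{L}(x^nQ_m(x))=0$ whenever $0\le n<m$. Set $\nu_{n,m}=\mathcal{L}(x^n/d_m(x))$. *)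

theory Defs
  imports
    Complex_Main
    "HOL-Computational_Algebra.Polynomial"
    "HOL-Computational_Algebra.Fraction_Field"
    "HOL-Computational_Algebra.Polynomial_Factorial"
    "Jordan_Normal_Form.Determinant"
begin

type_synonym ratfun = "complex poly fract"

definition ratfun_scale :: "complex \<Rightarrow> ratfun \<Rightarrow> ratfun" where
  "ratfun_scale c f = to_fract [:c:] * f"

global_interpretation ratfun: vector_space ratfun_scale
proof
  fix c e :: complex and f g :: ratfun
  show "ratfun_scale c (f + g) = ratfun_scale c f + ratfun_scale c g"
    by (simp add: ratfun_scale_def algebra_simps)
  have "[:c + e:] = [:c:] + [:e:]"
    by simp
  then show "ratfun_scale (c + e) f = ratfun_scale c f + ratfun_scale e f"
    unfolding ratfun_scale_def by (simp only: to_fract_add distrib_right)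
  have "[:c * e:] = [:c:] * [:e:]"
    by simp
  then show "ratfun_scale c (ratfun_scale e f) = ratfun_scale (c * e) f"
    unfolding ratfun_scale_def by (simp only: to_fract_mult mult.assoc)
  show "ratfun_scale 1 f = f"
    by (simp add: ratfun_scale_def flip: one_pCons)
qed

text \<open>The case expression encodes the convention \<open>P\<^sub>-\<^sub>1 = 0\<close>; thus the values
  \<open>a 0\<close> and \<open>l 0\<close> are irrelevant.\<close>

fun RI_P :: "(nat \<Rightarrow> complex) \<Rightarrow> (nat \<Rightarrow> complex) \<Rightarrow> (nat \<Rightarrow> complex) \<Rightarrow> nat \<Rightarrow> complex poly" where
  "RI_P b a l 0 = 1"
| "RI_P b a l (Suc n) =
     [:- b n, 1:] * RI_P b a l n
     - [:l n, a n:] * (case n of 0 \<Rightarrow> 0 | Suc k \<Rightarrow> RI_P b a l k)"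

definition RI_d :: "(nat \<Rightarrow> complex) \<Rightarrow> (nat \<Rightarrow> complex) \<Rightarrow> nat \<Rightarrow> complex poly" where
  "RI_d a l m = (\<Prod>i=1..m. [:l i, a i:])"

definition RI_Q :: "(nat \<Rightarrow> complex) \<Rightarrow> (nat \<Rightarrow> complex) \<Rightarrow> (nat \<Rightarrow> complex) \<Rightarrow> nat \<Rightarrow> ratfun" where
  "RI_Q b a l m = to_fract (RI_P b a l m) / to_fract (RI_d a l m)"

definition RI_V :: "(nat \<Rightarrow> complex) \<Rightarrow> (nat \<Rightarrow> complex) \<Rightarrow> (nat \<Rightarrow> complex) \<Rightarrow> ratfun set" where
  "RI_V b a l = ratfun.span {to_fract (monom 1 n) * RI_Q b a l m | n m. True}"

text \<open>A functional on \<open>V\<close> is a HOL function on all rational functions of which only the values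
  on \<open>V\<close> are constrained.\<close>

definition linear_functional_on :: "ratfun set \<Rightarrow> (ratfun \<Rightarrow> complex) \<Rightarrow> bool" where
  "linear_functional_on V L \<longleftrightarrow>
     (\<forall>f\<in>V. \<forall>g\<in>V. L (f + g) = L f + L g) \<and>
     (\<forall>c. \<forall>f\<in>V. L (ratfun_scale c f) = c * L f)"

definition RI_functional ::
  "(nat \<Rightarrow> complex) \<Rightarrow> (nat \<Rightarrow> complex) \<Rightarrow> (nat \<Rightarrow> complex) \<Rightarrow> (ratfun \<Rightarrow> complex) \<Rightarrow> bool" where
  "RI_functional b a l L \<longleftrightarrow>
     linear_functional_on (RI_V b a l) L \<and>
     L 1 = 1 \<and>
     (\<forall>n m. n < m \<longrightarrow> L (to_fract (monom 1 n) * RI_Q b a l m) = 0)"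

definition RI_moment ::
  "(nat \<Rightarrow> complex) \<Rightarrow> (nat \<Rightarrow> complex) \<Rightarrow> (ratfun \<Rightarrow> complex) \<Rightarrow> nat \<Rightarrow> nat \<Rightarrow> complex" where
  "RI_moment a l L n m = L (to_fract (monom 1 n) / to_fract (RI_d a l m))"

definition RI_Delta ::
  "(nat \<Rightarrow> complex) \<Rightarrow> (nat \<Rightarrow> complex) \<Rightarrow> (ratfun \<Rightarrow> complex) \<Rightarrow> nat \<Rightarrow> complex" where
  "RI_Delta a l L n = det (mat (n + 1) (n + 1) (\<lambda>(i, j). RI_moment a l L (i + j) n))"

end

theory Submission
  imports Defs
begin

text \<open>Write \<open>D\<^sub>n\<close> for the leading \<open>n \<times> n\<close> minor of the matrix \<open>(\<nu>\<^bsub>i+j,n\<^esub>)\<^bsub>0\<le>i,j\<le>n\<^esub>\<close>. Adding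
  multiples of the other columns to the last one so that it records multiplication by \<open>P\<^sub>n\<close> turns
  the matrix with last row \<open>(1, x, \<dots>, x\<^sup>n)\<close> into a block triangular one with determinant
  \<open>D\<^sub>n P\<^sub>n(x)\<close>, and likewise yields \<open>\<Delta>'\<^sub>n = D\<^sub>n L(x\<^sup>n Q\<^sub>n)\<close>. Applying \<open>L\<close> to \<open>x\<^bsup>n-1\<^esup>\<close> times the recurrence
  divided by \<open>d\<^sub>n\<close> gives \<open>L(x\<^sup>n Q\<^sub>n) = L(x\<^bsup>n-1\<^esup> Q\<^bsub>n-1\<^esub>) = \<dots> = 1\<close>, so \<open>D\<^sub>n = \<Delta>'\<^sub>n\<close>.
  Finally, subtracting \<open>c = -\<lambda>\<^sub>n/a\<^sub>n\<close> times each column from the next one in the matrix with last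
  row \<open>(1, c, \<dots>, c\<^sup>n)\<close> turns the moments for \<open>d\<^sub>n\<close> into those for \<open>d\<^bsub>n-1\<^esub>\<close> and shows
  \<open>\<Delta>'\<^bsub>n-1\<^esub> = (-a\<^sub>n)\<^sup>n P\<^sub>n(c) D\<^sub>n\<close>.\<close>

section \<open>Determinants under unitriangular column operations\<close>

text \<open>Right multiplication by the identity with its last column replaced by \<open>p\<close>
  preserves the determinant, since \<open>p n = 1\<close>. It clears the last column above the
  corner, and Laplace expansion finishes. The last row of \<open>f\<close> stays arbitrary, so the
  same lemma serves rows of moments, of monomials and of powers of a number.\<close>

lemma det_last_column_combination:
  fixes f :: "nat \<Rightarrow> nat \<Rightarrow> 'a :: comm_ring_1" and p :: "nat \<Rightarrow> 'a"
  assumes monic: "p n = 1"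
    and orth: "\<And>i. i < n \<Longrightarrow> (\<Sum>j\<le>n. f i j * p j) = 0"
  shows "det (mat (n + 1) (n + 1) (\<lambda>(i, j). f i j))
    = (\<Sum>j\<le>n. f n j * p j) * det (mat n n (\<lambda>(i, j). f i j))"
proof -
  define M where "M = mat (n + 1) (n + 1) (\<lambda>(i, j). f i j)"
  define T where "T = mat (n + 1) (n + 1) (\<lambda>(i, j). if j < n then (if i = j then 1 else 0) else p i)"
  have car: "M \<in> carrier_mat (n + 1) (n + 1)" "T \<in> carrier_mat (n + 1) (n + 1)"
    by (simp_all add: M_def T_def)
  have "det T = prod_list (diag_mat T)"
    by (rule det_upper_triangular[OF _ car(2)]) (auto simp: T_def upper_triangular_def)
  also have "\<dots> = (\<Prod>i<n + 1. T $$ (i, i))"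
    using car(2) by (simp add: prod_list_diag_prod atLeast0LessThan)
  also have "\<dots> = 1"
    using monic by (intro prod.neutral) (auto simp: T_def less_Suc_eq)
  finally have det_T: "det T = 1" .
  have MT: "(M * T) $$ (i, j) = (if j < n then f i j else \<Sum>k\<le>n. f i k * p k)"
    if "i < n + 1" "j < n + 1" for i j
  proof -
    have "(M * T) $$ (i, j) = (\<Sum>k<n + 1. f i k * T $$ (k, j))"
      using that by (simp add: M_def T_def scalar_prod_def atLeast0LessThan)
    also have "\<dots> = (if j < n then f i j else \<Sum>k\<le>n. f i k * p k)"
    proof (cases "j < n")
      case True
      have "(\<Sum>k<n + 1. f i k * T $$ (k, j)) = (\<Sum>k<n + 1. if k = j then f i k else 0)"
        using that True by (intro sum.cong) (auto simp: T_def)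
      then show ?thesis
        using that True by simp
    next
      case False
      then show ?thesis
        using that by (auto simp: T_def lessThan_Suc_atMost intro!: sum.cong)
    qed
    finally show ?thesis .
  qed
  have car_MT: "M * T \<in> carrier_mat (n + 1) (n + 1)"
    using car by simp
  have "det M = det (M * T)"
    using det_mult[OF car] det_T by simp
  also have "\<dots> = (\<Sum>i<n + 1. (M * T) $$ (i, n) * cofactor (M * T) i n)"
    by (rule laplace_expansion_column[OF car_MT]) simp
  also have "\<dots> = (\<Sum>i<n + 1. if i = n then (\<Sum>k\<le>n. f n k * p k) * cofactor (M * T) n n else 0)"
    using orth by (intro sum.cong) (auto simp: MT less_Suc_eq simp del: index_mult_mat)
  also have "\<dots> = (\<Sum>k\<le>n. f n k * p k) * cofactor (M * T) n n"
    by simp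
  also have "cofactor (M * T) n n = det (mat n n (\<lambda>(i, j). f i j))"
  proof -
    have "mat_delete (M * T) n n = mat n n (\<lambda>(i, j). f i j)"
      using car_MT by (intro eq_matI) (auto simp: mat_delete_def MT simp del: index_mult_mat)
    then show ?thesis
      by (simp add: cofactor_def)
  qed
  finally show ?thesis
    by (simp add: M_def)
qed

text \<open>Subtracting \<open>c\<close> times each column from the next, all at once through a
  bidiagonal \<open>T\<close>, turns the last row into (1, 0, ..., 0). The sign comes from the
  surviving corner entry at position (n, 0).\<close>

lemma det_last_row_powers:
  fixes f :: "nat \<Rightarrow> nat \<Rightarrow> 'a :: comm_ring_1" and c :: 'a
  shows "det (mat (n + 1) (n + 1) (\<lambda>(i, j). if i < n then f i j else c ^ j))
    = (- 1) ^ n * det (mat n n (\<lambda>(i, j). f i (Suc j) - c * f i j))"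
proof -
  define g where "g i j = (if i < n then f i j else c ^ j)" for i j
  define M where "M = mat (n + 1) (n + 1) (\<lambda>(i, j). g i j)"
  define T where
    "T = mat (n + 1) (n + 1) (\<lambda>(i, j). if i = j then 1 else if j = Suc i then - c else 0)"
  have car: "M \<in> carrier_mat (n + 1) (n + 1)" "T \<in> carrier_mat (n + 1) (n + 1)"
    by (simp_all add: M_def T_def)
  have "det T = prod_list (diag_mat T)"
    by (rule det_upper_triangular[OF _ car(2)]) (auto simp: T_def upper_triangular_def)
  also have "\<dots> = (\<Prod>i<n + 1. T $$ (i, i))"
    using car(2) by (simp add: prod_list_diag_prod atLeast0LessThan)
  also have "\<dots> = 1"
    by (intro prod.neutral) (auto simp: T_def)
  finally have det_T: "det T = 1" .
  have MT: "(M * T) $$ (i, j) = (case j of 0 \<Rightarrow> g i 0 | Suc k \<Rightarrow> g i (Suc k) - c * g i k)"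
    if "i < n + 1" "j < n + 1" for i j
  proof -
    have "(M * T) $$ (i, j) = (\<Sum>k<n + 1. g i k * T $$ (k, j))"
      using that by (simp add: M_def T_def scalar_prod_def atLeast0LessThan)
    also have "\<dots> = (\<Sum>k<n + 1. (if k = j then g i k else 0) + (if j = Suc k then - c * g i k else 0))"
      using that by (intro sum.cong) (auto simp: T_def)
    also have "\<dots> = g i j + (\<Sum>k<n + 1. if j = Suc k then - c * g i k else 0)"
      using that by (simp only: sum.distrib) simp
    also have "\<dots> = (case j of 0 \<Rightarrow> g i 0 | Suc k \<Rightarrow> g i (Suc k) - c * g i k)"
      using that by (cases j) simp_all
    finally show ?thesis .
  qed
  have car_MT: "M * T \<in> carrier_mat (n + 1) (n + 1)"
    using car by simp
  have "det M = det (M * T)"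
    using det_mult[OF car] det_T by simp
  also have "\<dots> = (\<Sum>j<n + 1. (M * T) $$ (n, j) * cofactor (M * T) n j)"
    by (rule laplace_expansion_row[OF car_MT]) simp
  \<comment> \<open>For \<open>j = Suc k\<close> the entry is
    \<open>c ^ Suc k - c * c ^ k = 0\<close>.\<close>
  also have "\<dots> = (\<Sum>j<n + 1. if j = 0 then cofactor (M * T) n 0 else 0)"
    by (intro sum.cong) (auto simp: MT g_def simp del: index_mult_mat split: nat.split)
  also have "\<dots> = cofactor (M * T) n 0"
    by simp
  also have "\<dots> = (- 1) ^ n * det (mat n n (\<lambda>(i, j). f i (Suc j) - c * f i j))"
  proof -
    have "mat_delete (M * T) n 0 = mat n n (\<lambda>(i, j). f i (Suc j) - c * f i j)"
      using car_MT
      by (intro eq_matI) (auto simp: mat_delete_def MT g_def simp del: index_mult_mat)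
    then show ?thesis
      by (simp add: cofactor_def)
  qed
  finally show ?thesis
    by (simp add: M_def g_def)
qed

lemma det_mat_const_poly:
  fixes f :: "nat \<Rightarrow> nat \<Rightarrow> 'a :: comm_ring_1"
  shows "det (mat n n (\<lambda>(i, j). [:f i j:])) = [:det (mat n n (\<lambda>(i, j). f i j)):]"
proof -
  interpret comm_ring_hom "\<lambda>c :: 'a. [:c:]"
    by unfold_locales (simp_all add: one_pCons)
  have "mat n n (\<lambda>(i, j). [:f i j:]) = map_mat (\<lambda>c. [:c:]) (mat n n (\<lambda>(i, j). f i j))"
    by (intro eq_matI) auto
  then show ?thesis
    by (simp add: hom_det)
qed

section \<open>Recurrence polynomials and their quotients\<close>

lemma RI_P_monic: "degree (RI_P b a l n) \<le> n \<and> coeff (RI_P b a l n) n = 1"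
proof (induction n rule: less_induct)
  case (less n)
  show ?case
  proof (cases n)
    case 0
    then show ?thesis by simp
  next
    case (Suc m)
    let ?R = "case m of 0 \<Rightarrow> 0 | Suc k \<Rightarrow> RI_P b a l k"
    have IH: "degree (RI_P b a l m) \<le> m" "coeff (RI_P b a l m) m = 1"
      using less Suc by auto
    have R: "degree ([:l m, a m:] * ?R) \<le> m"
    proof (cases m)
      case (Suc k)
      then have "degree (RI_P b a l k) \<le> k"
        using less.IH[of k] \<open>n = Suc m\<close> by auto
      then show ?thesis
        using degree_mult_le[of "[:l m, a m:]" "RI_P b a l k"] Suc
        by (auto split: if_splits)
    qed simp
    have "degree ([:- b m, 1:] * RI_P b a l m) \<le> Suc m"
      using degree_mult_le[of "[:- b m, 1:]" "RI_P b a l m"] IH by simp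
    then have "degree (RI_P b a l (Suc m)) \<le> Suc m"
      using R by (auto intro: degree_diff_le)
    moreover have "coeff (RI_P b a l (Suc m)) (Suc m) = 1"
      using IH coeff_eq_0[of "[:l m, a m:] * ?R" "Suc m"] R
      by (simp add: coeff_eq_0)
    ultimately show ?thesis
      using Suc by blast
  qed
qed

lemma RI_d_Suc: "RI_d a l (Suc m) = RI_d a l m * [:l (Suc m), a (Suc m):]"
  by (simp add: RI_d_def)

lemma ratfun_scale_of_poly_quotient:
  "ratfun_scale c (to_fract p / to_fract q) = to_fract (smult c p) / to_fract q"
proof -
  have "to_fract (smult c p) = to_fract [:c:] * to_fract p"
    by (simp flip: to_fract_mult)
  then show ?thesis
    by (simp add: ratfun_scale_def)
qed

section \<open>Rational functions belonging to V\<close>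

locale RI_system =
  fixes b a l :: "nat \<Rightarrow> complex" and L :: "ratfun \<Rightarrow> complex"
  assumes a_nz: "\<And>n. n \<ge> 1 \<Longrightarrow> a n \<noteq> 0"
    and P_nz: "\<And>n. n \<ge> 1 \<Longrightarrow> poly (RI_P b a l n) (- l n / a n) \<noteq> 0"
    and functional: "RI_functional b a l L"
begin

abbreviation P where "P \<equiv> RI_P b a l"
abbreviation d where "d \<equiv> RI_d a l"
abbreviation \<nu> where "\<nu> \<equiv> RI_moment a l L"
abbreviation \<Delta> where "\<Delta> \<equiv> RI_Delta a l L"

lemma d_nz: "d m \<noteq> 0"
  using a_nz by (auto simp: RI_d_def)

lemma monom_P_in_V: "to_fract (monom 1 n * P m) / to_fract (d m) \<in> RI_V b a l"
  unfolding RI_V_def by (rule ratfun.span_base) (auto simp: RI_Q_def to_fract_mult)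

text \<open>Since \<open>P\<^bsub>m+1\<^esub>\<close> does not vanish at the root of \<open>a\<^bsub>m+1\<^esub> x + \<lambda>\<^bsub>m+1\<^esub>\<close>, division with remainder
  expresses \<open>x\<^sup>n / d\<^bsub>m+1\<^esub>\<close> through \<open>x\<^sup>n Q\<^bsub>m+1\<^esub>\<close> and a polynomial over \<open>d\<^sub>m\<close>.\<close>

lemma poly_over_d_in_V: "to_fract p / to_fract (d m) \<in> RI_V b a l"
proof -
  \<comment> \<open>V is a linear span, so it suffices to treat monomial numerators.\<close>
  have reduce: "to_fract p / to_fract (d m) \<in> RI_V b a l"
    if monom: "\<And>n. to_fract (monom 1 n) / to_fract (d m) \<in> RI_V b a l" for p m
  proof -
    have "to_fract p / to_fract (d m)
      = (\<Sum>i\<le>degree p. ratfun_scale (coeff p i) (to_fract (monom 1 i) / to_fract (d m)))"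
    proof -
      have "to_fract p = (\<Sum>i\<le>degree p. to_fract (monom (coeff p i) i))"
        by (subst poly_as_sum_of_monoms[symmetric]) (rule to_fract_sum)
      then show ?thesis
        by (simp add: ratfun_scale_of_poly_quotient smult_monom sum_divide_distrib)
    qed
    also have "\<dots> \<in> RI_V b a l"
      using monom unfolding RI_V_def by (intro ratfun.span_sum ratfun.span_scale)
    finally show ?thesis .
  qed
  show ?thesis
  proof (induction m arbitrary: p)
    case 0
    show ?case
      by (rule reduce) (use monom_P_in_V[of _ 0] in simp)
  next
    case (Suc m)
    define c where "c = - l (Suc m) / a (Suc m)"
    define r where "r = poly (P (Suc m)) c"
    have a: "a (Suc m) \<noteq> 0" and r: "r \<noteq> 0"
      using a_nz[of "Suc m"] P_nz[of "Suc m"] by (simp_all add: r_def c_def)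
    have "[:- c, 1:] dvd P (Suc m) - [:r:]"
      by (simp add: poly_eq_0_iff_dvd[symmetric] r_def)
    then obtain q' where q': "P (Suc m) - [:r:] = [:- c, 1:] * q'"
      by (elim dvdE)
    define q where "q = smult (1 / a (Suc m)) q'"
    have lin: "[:l (Suc m), a (Suc m):] = smult (a (Suc m)) [:- c, 1:]"
      using a by (simp add: c_def)
    have q: "[:r:] = P (Suc m) - [:l (Suc m), a (Suc m):] * q"
      using a q' unfolding q_def lin by (simp add: algebra_simps)
    show ?case
    proof (rule reduce)
      fix n
      have "to_fract (monom 1 n * [:r:]) / to_fract (d (Suc m))
        = to_fract (monom 1 n * P (Suc m)) / to_fract (d (Suc m))
          - to_fract (monom 1 n * q) / to_fract (d m)"
        unfolding q using d_nz[of m] a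
        by (simp add: RI_d_Suc to_fract_mult to_fract_diff field_simps
            del: mult_pCons_left mult_pCons_right)
      also have "\<dots> \<in> RI_V b a l"
        using monom_P_in_V Suc.IH unfolding RI_V_def by (rule ratfun.span_diff)
      finally have "ratfun_scale (1 / r)
          (to_fract (monom 1 n * [:r:]) / to_fract (d (Suc m))) \<in> RI_V b a l"
        unfolding RI_V_def by (rule ratfun.span_scale)
      then show "to_fract (monom 1 n) / to_fract (d (Suc m)) \<in> RI_V b a l"
        using r by (simp add: ratfun_scale_of_poly_quotient smult_monom)
    qed
  qed
qed

section \<open>The functional acting on numerators\<close>

text \<open>Fixing the denominator replaces fractions by polynomials. As \<open>L\<close> is
  constrained on V alone, linearity of \<open>\<Lambda> m\<close> rests on
  \<open>poly_over_d_in_V\<close>.\<close>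

definition \<Lambda> :: "nat \<Rightarrow> complex poly \<Rightarrow> complex" where
  "\<Lambda> m p = L (to_fract p / to_fract (d m))"

lemma Lambda_add: "\<Lambda> m (p + q) = \<Lambda> m p + \<Lambda> m q"
  using functional poly_over_d_in_V
  by (simp add: \<Lambda>_def RI_functional_def linear_functional_on_def to_fract_add add_divide_distrib)

lemma Lambda_smult: "\<Lambda> m (smult c p) = c * \<Lambda> m p"
  using functional poly_over_d_in_V
  by (simp add: \<Lambda>_def RI_functional_def linear_functional_on_def
      flip: ratfun_scale_of_poly_quotient)

lemma Lambda_0: "\<Lambda> m 0 = 0"
  using Lambda_smult[of m 0 0] by simp

lemma Lambda_diff: "\<Lambda> m (p - q) = \<Lambda> m p - \<Lambda> m q"
  using Lambda_add[of m p "smult (- 1) q"] Lambda_smult[of m "- 1" q] by simp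

lemma Lambda_sum: "\<Lambda> m (\<Sum>i\<in>A. f i) = (\<Sum>i\<in>A. \<Lambda> m (f i))"
  by (induction A rule: infinite_finite_induct) (simp_all add: Lambda_0 Lambda_add)

lemma Lambda_monom: "\<Lambda> m (monom 1 n) = \<nu> n m"
  by (simp add: \<Lambda>_def RI_moment_def)

text \<open>The linear factor cancels against the last factor of \<open>d (Suc m)\<close>; this is
  how moments for consecutive denominators are compared.\<close>

lemma Lambda_Suc: "\<Lambda> (Suc m) ([:l (Suc m), a (Suc m):] * p) = \<Lambda> m p"
proof -
  have "[:l (Suc m), a (Suc m):] \<noteq> 0"
    using a_nz[of "Suc m"] by simp
  then show ?thesis
    unfolding \<Lambda>_def RI_d_Suc to_fract_mult by simp
qed

lemma Lambda_monom_P: "n < m \<Longrightarrow> \<Lambda> m (monom 1 n * P m) = 0"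
  using functional by (simp add: \<Lambda>_def RI_functional_def RI_Q_def to_fract_mult)

lemma Lambda_monom_mult:
  assumes "degree p \<le> n"
  shows "\<Lambda> m (monom 1 i * p) = (\<Sum>j\<le>n. \<nu> (i + j) m * coeff p j)"
proof -
  have "monom 1 i * p = monom 1 i * (\<Sum>j\<le>n. monom (coeff p j) j)"
    using assms by (simp add: poly_as_sum_of_monoms')
  also have "\<dots> = (\<Sum>j\<le>n. smult (coeff p j) (monom 1 (i + j)))"
    by (simp add: sum_distrib_left mult_monom smult_monom)
  finally show ?thesis
    by (simp add: Lambda_sum Lambda_smult Lambda_monom mult.commute)
qed

lemma Lambda_monom_P_same: "\<Lambda> n (monom 1 n * P n) = 1"
proof (induction n)
  case 0
  then show ?case
    using functional by (simp add: \<Lambda>_def RI_functional_def RI_d_def)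
next
  case (Suc k)
  let ?n = "Suc k"
  have "monom 1 k * P (Suc ?n)
    = monom 1 ?n * P ?n - smult (b ?n) (monom 1 k * P ?n) - [:l ?n, a ?n:] * (monom 1 k * P k)"
  proof -
    have "P (Suc ?n) = [:- b ?n, 1:] * P ?n - [:l ?n, a ?n:] * P k"
      unfolding RI_P.simps(2)[of b a l ?n] by (simp only: nat.case)
    then show ?thesis
      by (simp only: monom_Suc) (simp add: algebra_simps del: RI_P.simps)
  qed
  \<comment> \<open>The middle term vanishes by orthogonality because \<open>k < ?n\<close>; the
    last one drops to level \<open>k\<close>, where the induction hypothesis gives 1.\<close>
  then have "\<Lambda> ?n (monom 1 k * P (Suc ?n)) = \<Lambda> ?n (monom 1 ?n * P ?n) - 1"
    using Suc by (simp only: Lambda_diff Lambda_smult Lambda_Suc Lambda_monom_P) simp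
  \<comment> \<open>Enlarging the denominator to \<open>d (Suc ?n)\<close> makes both terms on the
    right vanish, since \<open>k\<close> and \<open>?n\<close> are below
    \<open>Suc ?n\<close>.\<close>
  moreover have "\<Lambda> ?n (monom 1 k * P (Suc ?n))
    = l (Suc ?n) * \<Lambda> (Suc ?n) (monom 1 k * P (Suc ?n))
      + a (Suc ?n) * \<Lambda> (Suc ?n) (monom 1 ?n * P (Suc ?n))"
  proof -
    have "[:l (Suc ?n), a (Suc ?n):] * (monom 1 k * P (Suc ?n))
      = smult (l (Suc ?n)) (monom 1 k * P (Suc ?n))
        + smult (a (Suc ?n)) (monom 1 ?n * P (Suc ?n))"
      by (simp add: monom_Suc del: RI_P.simps)
    then show ?thesis
      by (subst Lambda_Suc[symmetric]) (simp only: Lambda_add Lambda_smult)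
  qed
  ultimately show ?case
    by (simp add: Lambda_monom_P del: RI_P.simps)
qed

section \<open>Evaluation of the moment determinants\<close>

definition D :: "nat \<Rightarrow> complex" where
  "D n = det (mat n n (\<lambda>(i, j). \<nu> (i + j) n))"

lemma moment_P_orthogonal: "i < n \<Longrightarrow> (\<Sum>j\<le>n. \<nu> (i + j) n * coeff (P n) j) = 0"
  using RI_P_monic by (simp add: Lambda_monom_P flip: Lambda_monom_mult)

lemma Delta_eq_D: "\<Delta> n = D n"
proof -
  have "\<Delta> n = (\<Sum>j\<le>n. \<nu> (n + j) n * coeff (P n) j) * D n"
    unfolding RI_Delta_def D_def
    by (rule det_last_column_combination) (use RI_P_monic moment_P_orthogonal in auto)
  also have "(\<Sum>j\<le>n. \<nu> (n + j) n * coeff (P n) j) = 1"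
    using RI_P_monic by (simp add: Lambda_monom_P_same flip: Lambda_monom_mult)
  finally show ?thesis
    by simp
qed

text \<open>The column combination is carried out over the ring of polynomials, with moments as
  constants; on the last row it reassembles \<open>P n\<close> from its coefficients.\<close>

lemma det_last_row_monomials:
  "det (mat (n + 1) (n + 1) (\<lambda>(i, j). if i < n then [:\<nu> (i + j) n:] else monom 1 j))
    = smult (\<Delta> n) (P n)"
proof -
  let ?f = "\<lambda>i j. if i < n then [:\<nu> (i + j) n:] else monom 1 j"
  have "det (mat (n + 1) (n + 1) (\<lambda>(i, j). ?f i j))
    = (\<Sum>j\<le>n. ?f n j * [:coeff (P n) j:]) * det (mat n n (\<lambda>(i, j). ?f i j))"
  proof (rule det_last_column_combination)
    fix i assume "i < n"
    then have "(\<Sum>j\<le>n. ?f i j * [:coeff (P n) j:]) = [:\<Sum>j\<le>n. \<nu> (i + j) n * coeff (P n) j:]"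
      by (simp add: sum_to_poly[symmetric] mult.commute)
    then show "(\<Sum>j\<le>n. ?f i j * [:coeff (P n) j:]) = 0"
      using moment_P_orthogonal[OF \<open>i < n\<close>] by simp
  qed (use RI_P_monic in \<open>simp add: one_pCons\<close>)
  also have "(\<Sum>j\<le>n. ?f n j * [:coeff (P n) j:]) = P n"
    using RI_P_monic by (simp add: smult_monom poly_as_sum_of_monoms')
  also have "mat n n (\<lambda>(i, j). ?f i j) = mat n n (\<lambda>(i, j). [:\<nu> (i + j) n:])"
    by (intro eq_matI) auto
  also have "det \<dots> = [:\<Delta> n:]"
    by (simp add: det_mat_const_poly Delta_eq_D D_def)
  finally show ?thesis
    by simp
qed

text \<open>One determinant, with last row the powers of the root \<open>c\<close>, is evaluated
  twice: by the coefficients of \<open>P (Suc n)\<close> and by column differences.\<close>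

lemma Delta_Suc:
  "\<Delta> n = (- a (Suc n)) ^ Suc n * poly (P (Suc n)) (- l (Suc n) / a (Suc n)) * \<Delta> (Suc n)"
proof -
  let ?N = "Suc n"
  define c where "c = - l ?N / a ?N"
  let ?f = "\<lambda>i j. if i < ?N then \<nu> (i + j) ?N else c ^ j"
  let ?E = "mat ?N ?N (\<lambda>(i, j). \<nu> (i + Suc j) ?N - c * \<nu> (i + j) ?N)"
  have a: "a ?N \<noteq> 0"
    using a_nz by simp
  have "det (mat (?N + 1) (?N + 1) (\<lambda>(i, j). ?f i j))
    = (\<Sum>j\<le>?N. ?f ?N j * coeff (P ?N) j) * det (mat ?N ?N (\<lambda>(i, j). ?f i j))"
  proof (rule det_last_column_combination)
    fix i assume "i < ?N"
    then show "(\<Sum>j\<le>?N. ?f i j * coeff (P ?N) j) = 0"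
      using moment_P_orthogonal[of i ?N] by (simp del: RI_P.simps sum.atMost_Suc)
  qed (use RI_P_monic in blast)
  also have "(\<Sum>j\<le>?N. ?f ?N j * coeff (P ?N) j) = poly (P ?N) c"
  proof -
    have "poly (P ?N) c = poly (\<Sum>j\<le>?N. monom (coeff (P ?N) j) j) c"
      using RI_P_monic by (simp only: poly_as_sum_of_monoms')
    then show ?thesis
      by (simp add: poly_sum poly_monom mult.commute del: RI_P.simps sum.atMost_Suc)
  qed
  also have "mat ?N ?N (\<lambda>(i, j). ?f i j) = mat ?N ?N (\<lambda>(i, j). \<nu> (i + j) ?N)"
    by (intro eq_matI) auto
  also have "det \<dots> = \<Delta> ?N"
    by (simp add: Delta_eq_D D_def)
  finally have "(- 1) ^ ?N * det ?E = poly (P ?N) c * \<Delta> ?N"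
    unfolding det_last_row_powers .
  from this[symmetric] have "det ?E = (- 1) ^ ?N * (poly (P ?N) c * \<Delta> ?N)"
    by (simp only: left_minus_one_mult_self)
  moreover have "\<Delta> n = a ?N ^ ?N * det ?E"
  proof -
    \<comment> \<open>This is \<open>Lambda_Suc\<close> for the numerator \<open>monom 1 k\<close>,
      with \<open>l ?N = - a ?N * c\<close>.\<close>
    have "\<nu> k n = a ?N * (\<nu> (Suc k) ?N - c * \<nu> k ?N)" for k
    proof -
      have "[:l ?N, a ?N:] * monom 1 k = smult (l ?N) (monom 1 k) + smult (a ?N) (monom 1 (Suc k))"
        by (simp add: monom_Suc)
      then have "\<nu> k n = l ?N * \<nu> k ?N + a ?N * \<nu> (Suc k) ?N"
        using Lambda_Suc[of n "monom 1 k"] by (simp only: Lambda_add Lambda_smult Lambda_monom)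
      then show ?thesis
        using a by (simp add: c_def field_simps)
    qed
    \<comment> \<open>A scalar taken out of a matrix of size \<open>?N\<close> contributes
      \<open>a ?N ^ ?N\<close>, which later absorbs the sign \<open>(- 1) ^ ?N\<close>.\<close>
    then have "mat (n + 1) (n + 1) (\<lambda>(i, j). \<nu> (i + j) n) = a ?N \<cdot>\<^sub>m ?E"
      by (intro eq_matI) auto
    then show ?thesis
      by (simp add: RI_Delta_def)
  qed
  ultimately show ?thesis
    by (simp add: c_def power_minus[of "a ?N"] del: RI_P.simps)
qed

lemma Delta_product:
  "\<Delta> n = (\<Prod>k=1..n. 1 / ((- a k) ^ k * poly (P k) (- l k / a k)))"
proof (induction n)
  case 0
  show ?case
    \<comment> \<open>\<open>D 0\<close> is the determinant of the empty matrix, hence 1, matching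
      the empty product.\<close>
    by (simp add: Delta_eq_D D_def)
next
  case (Suc n)
  let ?u = "(- a (Suc n)) ^ Suc n * poly (P (Suc n)) (- l (Suc n) / a (Suc n))"
  have "?u \<noteq> 0"
    using a_nz[of "Suc n"] P_nz[of "Suc n"] by (simp del: RI_P.simps)
  then have "\<Delta> (Suc n) = \<Delta> n * (1 / ?u)"
    unfolding Delta_Suc[of n] by simp
  then show ?case
    using Suc by (simp del: RI_P.simps)
qed

end

theorem theorem6p3:
  fixes b a l :: "nat \<Rightarrow> complex" and L :: "ratfun \<Rightarrow> complex"
  assumes a_nz: "\<And>n. n \<ge> 1 \<Longrightarrow> a n \<noteq> 0"
    and P_nz: "\<And>n. n \<ge> 1 \<Longrightarrow> poly (RI_P b a l n) (- l n / a n) \<noteq> 0"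
    and L: "RI_functional b a l L"
    and Delta_nz: "\<And>n. RI_Delta a l L n \<noteq> 0"
  shows "\<forall>n.
    RI_P b a l n =
      smult (1 / RI_Delta a l L n)
        (det (mat (n + 1) (n + 1)
          (\<lambda>(i, j). if i < n then [:RI_moment a l L (i + j) n:] else monom 1 j))) \<and>
    RI_Delta a l L n =
      (\<Prod>k=1..n. 1 / ((- a k) ^ k * poly (RI_P b a l k) (- l k / a k)))"
proof -
  interpret RI_system b a l L
    by unfold_locales (fact a_nz P_nz L)+
  show ?thesis
    unfolding det_last_row_monomials
    by (intro allI conjI Delta_product) (simp add: Delta_nz)
qed

end
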